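(* Let $n\ge 3$, let $\Gamma=C_n$ be the cycle graph with $n$ vertices, let $x_0$ be a vertex of $\Gamma$, and let $D=\lfloor n/2\rfloor$ be the diameter of $C_n$. Then \[ \mathcal{T}_2(\Gamma,x_0)=\mathcal{T}_3(\Gamma,x_0)=\mathcal{T}_4(\Gamma,x_0)\cong\begin{cases} M_{D+1}(\mathbb{C})\oplus M_{D-1}(\mathbb{C}) & \text{if } n \text{ is even},\\ M_{D+1}(\mathbb{C})\oplus M_{D}(\mathbb{C}) & \text{if } n \text{ is odd},\end{cases} \] where the isomorphism is of $\mathbb{C}$-algebras.
   Context: $C_n$ has vertex set $X=\{1,\dots,n\}$ and edge set $\{\{1,2\},\{2,3\},\dots,\{n-1,n\},\{n,1\}\}$. For a finite connected simple graph $\Gamma$ on $X$ with adjacency matrix $A$ and base vertex $x_0\in X$, $M_X(\mathbb{C})$ is the algebra of complex matrices with rows and columns indexed by $X$. For $Y\subset X$, $E_Y$ is the diagonal matrix with $(x,x)$-entry $1$ if $x\in Y$ and $0$ otherwise. $\mathbb{C}\langle S\rangle$ is the unital $\mathbb{C}$-subalgebra of $M_X(\mathbb{C})$ generated by $S$. Let $X_k=\{x\in X:\partial(x_0,x)=k\}$ for $0\le k\le\max_x\partial(x_0,x)$ (here this maximum equals $D$; $\partial$ is the graph distance), $G_{x_0}$ the stabilizer of $x_0$ in $\mathrm{Aut}(\Gamma)$, and $Y_1,\dots,Y_r$ the $G_{x_0}$-orbits on $X$. Then $\mathcal{T}_2(\Gamma,x_0)=\mathbb{C}\langle A,E_{X_0},\dots,E_{X_D}\rangle$,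 $\mathcal{T}_3(\Gamma,x_0)=\mathbb{C}\langle A,E_{Y_1},\dots,E_{Y_r}\rangle$, and $\mathcal{T}_4(\Gamma,x_0)=\{M\in M_X(\mathbb{C}): M_{\sigma(x),\sigma(y)}=M_{x,y}\ \text{for all } x,y\in X,\ \sigma\in G_{x_0}\}$. *)

theory Defs
  imports "Jordan_Normal_Form.Matrix" "HOL-Algebra.QuotRing"
begin

text \<open>
  A simple graph on the vertex set \<open>X = {1..n}\<close> is given by its set \<open>E\<close> of edges, each edge being
  a two-element subset of \<open>X\<close>. Matrices with rows and columns indexed by \<open>X\<close> are the library's
  \<open>n \<times> n\<close> matrices. As these are indexed from \<open>0\<close>, the vertex \<open>x\<close> corresponds to the row and
  column index \<open>x - 1\<close>.
\<close>

definition cycle_edges :: "nat \<Rightarrow> nat set set" where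
  "cycle_edges n = {{i, i + 1} | i. 1 \<le> i \<and> i < n} \<union> {{n, 1}}"

definition entry :: "complex mat \<Rightarrow> nat \<Rightarrow> nat \<Rightarrow> complex" where
  "entry M x y = M $$ (x - 1, y - 1)"

definition adjacency_matrix :: "nat \<Rightarrow> nat set set \<Rightarrow> complex mat" where
  "adjacency_matrix n E = mat n n (\<lambda>(i, j). if {i + 1, j + 1} \<in> E then 1 else 0)"

definition diag_idem :: "nat \<Rightarrow> nat set \<Rightarrow> complex mat" where
  "diag_idem n Y = mat n n (\<lambda>(i, j). if i = j \<and> i + 1 \<in> Y then 1 else 0)"

text \<open>Graph distance: the least length of a walk (meaningful for connected graphs).\<close>

definition graph_dist :: "nat set set \<Rightarrow> nat \<Rightarrow> nat \<Rightarrow> nat" where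
  "graph_dist E x y = (LEAST k. (x, y) \<in> {(u, v). {u, v} \<in> E} ^^ k)"

definition eccentricity :: "nat \<Rightarrow> nat set set \<Rightarrow> nat \<Rightarrow> nat" where
  "eccentricity n E x0 = Max (graph_dist E x0 ` {1..n})"

definition sphere_at :: "nat \<Rightarrow> nat set set \<Rightarrow> nat \<Rightarrow> nat \<Rightarrow> nat set" where
  "sphere_at n E x0 k = {x \<in> {1..n}. graph_dist E x0 x = k}"

definition graph_automorphisms :: "nat \<Rightarrow> nat set set \<Rightarrow> (nat \<Rightarrow> nat) set" where
  "graph_automorphisms n E =
    {\<sigma>. \<sigma> permutes {1..n} \<and> (\<forall>x\<in>{1..n}. \<forall>y\<in>{1..n}. {\<sigma> x, \<sigma> y} \<in> E \<longleftrightarrow> {x, y} \<in> E)}"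

definition vertex_stabilizer :: "nat \<Rightarrow> nat set set \<Rightarrow> nat \<Rightarrow> (nat \<Rightarrow> nat) set" where
  "vertex_stabilizer n E x0 = {\<sigma> \<in> graph_automorphisms n E. \<sigma> x0 = x0}"

definition stabilizer_orbits :: "nat \<Rightarrow> nat set set \<Rightarrow> nat \<Rightarrow> nat set set" where
  "stabilizer_orbits n E x0 = {{\<sigma> x | \<sigma>. \<sigma> \<in> vertex_stabilizer n E x0} | x. x \<in> {1..n}}"

definition unital_subalgebra :: "nat \<Rightarrow> complex mat set \<Rightarrow> bool" where
  "unital_subalgebra n B \<longleftrightarrow>
     B \<subseteq> carrier_mat n n \<and> 1\<^sub>m n \<in> B \<and>
     (\<forall>M\<in>B. \<forall>N\<in>B. M + N \<in> B \<and> M * N \<in> B) \<and>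
     (\<forall>c. \<forall>M\<in>B. c \<cdot>\<^sub>m M \<in> B)"

definition generated_algebra :: "nat \<Rightarrow> complex mat set \<Rightarrow> complex mat set" where
  "generated_algebra n S = unital_subalgebra n hull S"

definition T2 :: "nat \<Rightarrow> nat set set \<Rightarrow> nat \<Rightarrow> complex mat set" where
  "T2 n E x0 = generated_algebra n
     ({adjacency_matrix n E} \<union>
      {diag_idem n (sphere_at n E x0 k) | k. k \<le> eccentricity n E x0})"

definition T3 :: "nat \<Rightarrow> nat set set \<Rightarrow> nat \<Rightarrow> complex mat set" where
  "T3 n E x0 = generated_algebra n
     ({adjacency_matrix n E} \<union> {diag_idem n Y | Y. Y \<in> stabilizer_orbits n E x0})"

definition T4 :: "nat \<Rightarrow> nat set set \<Rightarrow> nat \<Rightarrow> complex mat set" where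
  "T4 n E x0 = {M \<in> carrier_mat n n.
     \<forall>x\<in>{1..n}. \<forall>y\<in>{1..n}. \<forall>\<sigma>\<in>vertex_stabilizer n E x0. entry M (\<sigma> x) (\<sigma> y) = entry M x y}"

text \<open>
  Algebras over the complex numbers are represented by records of the library type \<open>module\<close>, which
  carry a multiplication, a unit, an addition, a zero and a scalar multiplication. The full matrix
  algebra is \<open>module_mat\<close>.
\<close>

abbreviation mat_algebra :: "nat \<Rightarrow> (complex, complex mat) module" where
  "mat_algebra n \<equiv> module_mat TYPE(complex) n n"

definition algebra_sum ::
  "('r, 'a) module \<Rightarrow> ('r, 'b) module \<Rightarrow> ('r, 'a \<times> 'b) module" where
  "algebra_sum P Q = \<lparr>
     carrier = carrier P \<times> carrier Q,
     mult = (\<lambda>(p, q) (p', q'). (p \<otimes>\<^bsub>P\<^esub> p', q \<otimes>\<^bsub>Q\<^esub> q')),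
     one = (\<one>\<^bsub>P\<^esub>, \<one>\<^bsub>Q\<^esub>),
     zero = (\<zero>\<^bsub>P\<^esub>, \<zero>\<^bsub>Q\<^esub>),
     add = (\<lambda>(p, q) (p', q'). (p \<oplus>\<^bsub>P\<^esub> p', q \<oplus>\<^bsub>Q\<^esub> q')),
     smult = (\<lambda>c (p, q). (c \<odot>\<^bsub>P\<^esub> p, c \<odot>\<^bsub>Q\<^esub> q))\<rparr>"

definition algebra_isomorphic :: "(complex, 'a) module \<Rightarrow> (complex, 'b) module \<Rightarrow> bool" where
  "algebra_isomorphic P Q \<longleftrightarrow>
     (\<exists>f \<in> ring_iso P Q. \<forall>c. \<forall>a\<in>carrier P. f (c \<odot>\<^bsub>P\<^esub> a) = c \<odot>\<^bsub>Q\<^esub> f a)"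

text \<open>
  In the cycle graph, \<open>n div 2\<close> is the eccentricity of every vertex, hence the diameter.
\<close>

definition cycle_dist :: "nat \<Rightarrow> nat \<Rightarrow> nat \<Rightarrow> nat" where
  "cycle_dist n x y = (let d = (if x \<le> y then y - x else x - y) in min d (n - d))"

lemma cycle_edges_iff:
  assumes "n \<ge> 3"
  shows "{x, y} \<in> cycle_edges n \<longleftrightarrow> x \<in> {1..n} \<and> y \<in> {1..n} \<and>
    (y = x + 1 \<or> x = y + 1 \<or> (x = n \<and> y = 1) \<or> (x = 1 \<and> y = n))"
proof -
  have "{x, y} \<in> cycle_edges n \<longleftrightarrow>
      (\<exists>i. 1 \<le> i \<and> i < n \<and> (x = i \<and> y = i + 1 \<or> x = i + 1 \<and> y = i))
      \<or> (x = n \<and> y = 1) \<or> (x = 1 \<and> y = n)"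
    unfolding cycle_edges_def by (auto simp: doubleton_eq_iff)
  also have "\<dots> \<longleftrightarrow> x \<in> {1..n} \<and> y \<in> {1..n} \<and>
    (y = x + 1 \<or> x = y + 1 \<or> (x = n \<and> y = 1) \<or> (x = 1 \<and> y = n))"
    using assms by auto
  finally show ?thesis .
qed

lemma cycle_dist_up:
  assumes "x \<in> {1..n}" "y \<in> {1..n}" "y < n"
  shows "cycle_dist n x (y + 1) \<le> cycle_dist n x y + 1"
    and "cycle_dist n x y \<le> cycle_dist n x (y + 1) + 1"
proof -
  consider "x \<le> y" | "y < x" by linarith
  then have "cycle_dist n x (y + 1) \<le> cycle_dist n x y + 1 \<and>
    cycle_dist n x y \<le> cycle_dist n x (y + 1) + 1"
  proof cases
    case 1
    then obtain d where d: "y = x + d" by (auto simp: le_iff_add)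
    show ?thesis using assms(3) unfolding d cycle_dist_def by (auto simp: min_def)
  next
    case 2
    then obtain d where d: "x = y + 1 + d" by (auto simp: less_iff_Suc_add)
    show ?thesis unfolding d cycle_dist_def by (auto simp: min_def)
  qed
  then show "cycle_dist n x (y + 1) \<le> cycle_dist n x y + 1"
    and "cycle_dist n x y \<le> cycle_dist n x (y + 1) + 1" by auto
qed

lemma cycle_dist_wrap:
  assumes "x \<in> {1..n}"
  shows "cycle_dist n x n \<le> cycle_dist n x 1 + 1" "cycle_dist n x 1 \<le> cycle_dist n x n + 1"
  using assms by (auto simp: cycle_dist_def Let_def)

lemma cycle_dist_step:
  assumes "n \<ge> 3" "x \<in> {1..n}" "{y, z} \<in> cycle_edges n"
  shows "cycle_dist n x z \<le> cycle_dist n x y + 1"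
proof -
  have "y \<in> {1..n}" "z \<in> {1..n}"
    and "z = y + 1 \<or> y = z + 1 \<or> (y = n \<and> z = 1) \<or> (y = 1 \<and> z = n)"
    using assms(3) unfolding cycle_edges_iff[OF assms(1)] by blast+
  then show ?thesis
    using cycle_dist_up[OF assms(2), of y] cycle_dist_up[OF assms(2), of z]
      cycle_dist_wrap[OF assms(2)] by fastforce
qed

lemma cycle_dist_le_walk:
  assumes "n \<ge> 3" "x \<in> {1..n}"
  shows "(x, y) \<in> {(u, v). {u, v} \<in> cycle_edges n} ^^ k \<Longrightarrow> cycle_dist n x y \<le> k"
proof (induction k arbitrary: y)
  case 0
  then show ?case by (simp add: cycle_dist_def)
next
  case (Suc k)
  then obtain z where z: "(x, z) \<in> {(u, v). {u, v} \<in> cycle_edges n} ^^ k"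
    "{z, y} \<in> cycle_edges n" by auto
  show ?case using Suc.IH[OF z(1)] cycle_dist_step[OF assms z(2)] by simp
qed

lemma cycle_dist_pred:
  assumes "n \<ge> 3" "x \<in> {1..n}" "y \<in> {1..n}" "cycle_dist n x y = Suc k"
  shows "\<exists>z\<in>{1..n}. {z, y} \<in> cycle_edges n \<and> cycle_dist n x z = k"
proof -
  let ?up = "if y = n then 1 else y + 1" and ?dn = "if y = 1 then n else y - 1"
  have e: "?up \<in> {1..n}" "{?up, y} \<in> cycle_edges n" "?dn \<in> {1..n}" "{?dn, y} \<in> cycle_edges n"
    using assms(1,3) unfolding cycle_edges_iff[OF assms(1)] by auto
  have "cycle_dist n x ?up = k \<or> cycle_dist n x ?dn = k"
  proof (cases "x \<le> y")
    case True
    then obtain d where d: "y = x + d" by (auto simp: le_iff_add)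
    show ?thesis
    proof (cases "2 * d \<le> n")
      case True
      then have "cycle_dist n x ?dn = k"
        using assms unfolding d cycle_dist_def by (cases d) auto
      then show ?thesis ..
    next
      case False
      then have "cycle_dist n x ?up = k"
        using assms unfolding d cycle_dist_def by (cases "x + d = n") auto
      then show ?thesis ..
    qed
  next
    case False
    then obtain d where d: "x = y + 1 + d" by (auto simp: not_le less_iff_Suc_add)
    show ?thesis
    proof (cases "2 * (d + 1) \<le> n")
      case True
      then have "cycle_dist n x ?up = k"
        using assms unfolding d cycle_dist_def by auto
      then show ?thesis ..
    next
      case False
      then have "cycle_dist n x ?dn = k"
        using assms unfolding d cycle_dist_def by (cases "y = 1") auto
      then show ?thesis ..
    qed
  qed
  then show ?thesis using e by blast
qed

lemma cycle_dist_walk: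
  assumes "n \<ge> 3" "x \<in> {1..n}"
  shows "y \<in> {1..n} \<Longrightarrow> cycle_dist n x y = k \<Longrightarrow>
    (x, y) \<in> {(u, v). {u, v} \<in> cycle_edges n} ^^ k"
proof (induction k arbitrary: y)
  case 0
  then have "x = y" using assms by (auto simp: cycle_dist_def Let_def min_def split: if_splits)
  then show ?case by simp
next
  case (Suc k)
  obtain z where z: "z \<in> {1..n}" "{z, y} \<in> cycle_edges n" "cycle_dist n x z = k"
    using cycle_dist_pred[OF assms Suc.prems] by auto
  show ?case using Suc.IH[OF z(1,3)] z(2) by auto
qed

lemma graph_dist_cycle:
  assumes "n \<ge> 3" "x \<in> {1..n}" "y \<in> {1..n}"
  shows "graph_dist (cycle_edges n) x y = cycle_dist n x y"
  unfolding graph_dist_def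
  using cycle_dist_walk[OF assms refl] cycle_dist_le_walk[OF assms(1,2)]
  by (intro Least_equality)

lemma eccentricity_cycle:
  assumes "n \<ge> 3" "x0 \<in> {1..n}"
  shows "eccentricity n (cycle_edges n) x0 = n div 2"
proof -
  have im: "graph_dist (cycle_edges n) x0 ` {1..n} = cycle_dist n x0 ` {1..n}"
    using graph_dist_cycle[OF assms] by (intro image_cong) auto
  let ?z = "if x0 + n div 2 \<le> n then x0 + n div 2 else x0 - n div 2"
  have "?z \<in> {1..n}" "cycle_dist n x0 ?z = n div 2"
    using assms by (auto simp: cycle_dist_def Let_def min_def)
  then have "n div 2 \<in> cycle_dist n x0 ` {1..n}"
    by (intro rev_image_eqI[where x = ?z]) simp_all
  moreover have "cycle_dist n x0 y \<le> n div 2" for y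
    by (auto simp: cycle_dist_def Let_def min_def)
  ultimately show ?thesis
    unfolding eccentricity_def im by (intro Max_eqI) auto
qed

end

theory Submission
  imports Defs
begin

text \<open>
  The stabilizer of the root contains the reflection fixing it, and its orbits are the spheres
  around the root. The matrices invariant under the reflection are spanned by the sums of a matrix
  unit and its mirror image. Each such sum is a product of blocks of the adjacency matrix between
  consecutive spheres: multiplying blocks along an arc links two vertices on the same side of the
  root, and the round trip through the root links a vertex at distance one to its mirror image.
  Hence all invariant matrices lie in the algebra generated by the adjacency matrix and the
  sphere projections. An invariant matrix preserves the symmetric and the antisymmetric vectors,
  and its restrictions to these two spaces give the two matrix blocks: the symmetric space has
  one dimension for each sphere, the antisymmetric one for each sphere with two vertices.
\<close>

section \<open>Matrices indexed by vertices\<close>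

text \<open>Used for automorphisms: the image of a walk is a walk of the same length, so distances
  cannot increase.\<close>

lemma walk_map:
  assumes "\<And>u v. {u, v} \<in> E \<Longrightarrow> {f u, f v} \<in> E'"
  shows "(x, y) \<in> {(u, v). {u, v} \<in> E} ^^ k \<Longrightarrow> (f x, f y) \<in> {(u, v). {u, v} \<in> E'} ^^ k"
proof (induction k arbitrary: y)
  case (Suc k)
  then show ?case using assms by auto
qed simp

lemma entry_mat [simp]: "x \<in> {1..n} \<Longrightarrow> y \<in> {1..n} \<Longrightarrow>
    entry (mat n n f) x y = f (x - 1, y - 1)"
  by (auto simp: entry_def)

lemma entry_mult:
  assumes "M \<in> carrier_mat n n" "N \<in> carrier_mat n n" "x \<in> {1..n}" "y \<in> {1..n}"
  shows "entry (M * N) x y = (\<Sum>z\<in>{1..n}. entry M x z * entry N z y)"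
proof -
  have "entry (M * N) x y = (\<Sum>i\<in>{0..<n}. M $$ (x - 1, i) * N $$ (i, y - 1))"
    using assms by (auto simp: entry_def scalar_prod_def intro!: sum.cong)
  also have "\<dots> = (\<Sum>z\<in>{1..n}. entry M x z * entry N z y)"
    by (rule sum.reindex_bij_witness[where i = "\<lambda>z. z - 1" and j = Suc]) (auto simp: entry_def)
  finally show ?thesis .
qed

lemma entry_add: "N \<in> carrier_mat n n \<Longrightarrow> x \<in> {1..n} \<Longrightarrow> y \<in> {1..n} \<Longrightarrow>
    entry (M + N) x y = entry M x y + entry N x y"
  by (auto simp: entry_def)

lemma entry_minus: "N \<in> carrier_mat n n \<Longrightarrow> x \<in> {1..n} \<Longrightarrow> y \<in> {1..n} \<Longrightarrow>
    entry (M - N) x y = entry M x y - entry N x y"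
  by (auto simp: entry_def)

lemma entry_smult: "M \<in> carrier_mat n n \<Longrightarrow> x \<in> {1..n} \<Longrightarrow> y \<in> {1..n} \<Longrightarrow>
    entry (c \<cdot>\<^sub>m M) x y = c * entry M x y"
  by (auto simp: entry_def)

lemma entry_one: "x \<in> {1..n} \<Longrightarrow> y \<in> {1..n} \<Longrightarrow> entry (1\<^sub>m n) x y = (if x = y then 1 else 0)"
  by (auto simp: entry_def)

lemma entry_diag_idem: "x \<in> {1..n} \<Longrightarrow> y \<in> {1..n} \<Longrightarrow>
    entry (diag_idem n Y) x y = (if x = y \<and> x \<in> Y then 1 else 0)"
  by (cases x; cases y) (auto simp: diag_idem_def)

lemma entry_adjacency_matrix: "x \<in> {1..n} \<Longrightarrow> y \<in> {1..n} \<Longrightarrow>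
    entry (adjacency_matrix n E) x y = (if {x, y} \<in> E then 1 else 0)"
  by (auto simp: adjacency_matrix_def)

lemma mat_eqI_entry:
  assumes "M \<in> carrier_mat n n" "N \<in> carrier_mat n n"
    "\<And>x y. x \<in> {1..n} \<Longrightarrow> y \<in> {1..n} \<Longrightarrow> entry M x y = entry N x y"
  shows "M = N"
proof (rule eq_matI)
  show "M $$ (i, j) = N $$ (i, j)" if "i < dim_row N" "j < dim_col N" for i j
    using assms(3)[of "Suc i" "Suc j"] that assms(2) by (auto simp: entry_def)
qed (use assms in auto)

lemma diag_idem_carrier [simp]: "diag_idem n Y \<in> carrier_mat n n"
  by (simp add: diag_idem_def)

lemma adjacency_matrix_carrier [simp]: "adjacency_matrix n E \<in> carrier_mat n n"
  by (simp add: adjacency_matrix_def)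

lemma entry_diag_idem_mult:
  assumes "M \<in> carrier_mat n n" "x \<in> {1..n}" "y \<in> {1..n}"
  shows "entry (diag_idem n Y * M) x y = (if x \<in> Y then entry M x y else 0)"
    and "entry (M * diag_idem n Y) x y = (if y \<in> Y then entry M x y else 0)"
proof -
  have "entry (diag_idem n Y * M) x y = (\<Sum>z\<in>{1..n}. if z = x then (if x \<in> Y then entry M x y else 0) else 0)"
    unfolding entry_mult[OF diag_idem_carrier assms] using assms
    by (intro sum.cong) (auto simp: entry_diag_idem)
  then show "entry (diag_idem n Y * M) x y = (if x \<in> Y then entry M x y else 0)"
    using assms by simp
  have "entry (M * diag_idem n Y) x y = (\<Sum>z\<in>{1..n}. if z = y then (if y \<in> Y then entry M x y else 0) else 0)"
    unfolding entry_mult[OF assms(1) diag_idem_carrier assms(2,3)] using assms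
    by (intro sum.cong) (auto simp: entry_diag_idem)
  then show "entry (M * diag_idem n Y) x y = (if y \<in> Y then entry M x y else 0)"
    using assms by simp
qed

text \<open>The full matrix algebra is one of the subalgebras containing \<open>S\<close>. It bounds
  their intersection by \<open>carrier_mat n n\<close>, and the closure properties pass to the
  intersection.\<close>

lemma unital_subalgebra_generated_algebra: "S \<subseteq> carrier_mat n n \<Longrightarrow> unital_subalgebra n (generated_algebra n S)"
proof -
  assume S: "S \<subseteq> carrier_mat n n"
  have "unital_subalgebra n (carrier_mat n n)" by (auto simp: unital_subalgebra_def)
  then have "generated_algebra n S \<subseteq> carrier_mat n n"
    unfolding generated_algebra_def using S by (rule hull_minimal[rotated])
  then show ?thesis
    unfolding generated_algebra_def hull_def unital_subalgebra_def by auto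
qed

lemma unital_subalgebraD:
  assumes "unital_subalgebra n B"
  shows "M \<in> B \<Longrightarrow> M \<in> carrier_mat n n" "1\<^sub>m n \<in> B"
    "M \<in> B \<Longrightarrow> N \<in> B \<Longrightarrow> M + N \<in> B" "M \<in> B \<Longrightarrow> N \<in> B \<Longrightarrow> M * N \<in> B"
    "M \<in> B \<Longrightarrow> c \<cdot>\<^sub>m M \<in> B"
  using assms by (auto simp: unital_subalgebra_def)

lemma unital_subalgebra_minus:
  assumes "unital_subalgebra n B" "M \<in> B" "N \<in> B"
  shows "M - N \<in> B"
proof -
  have "M + (-1) \<cdot>\<^sub>m N \<in> B" "M \<in> carrier_mat n n" "N \<in> carrier_mat n n"
    using assms by (auto simp: unital_subalgebra_def)
  moreover from this have "M + (-1) \<cdot>\<^sub>m N = M - N" by (intro eq_matI) auto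
  ultimately show ?thesis by simp
qed

text \<open>The type \<open>complex mat\<close> holds matrices of all sizes and has no single zero,
  so the linear combination is written entry by entry.\<close>

lemma unital_subalgebra_sum:
  assumes B: "unital_subalgebra n B" and "finite S" "\<And>s. s \<in> S \<Longrightarrow> F s \<in> B"
  shows "mat n n (\<lambda>(i, j). \<Sum>s\<in>S. c s * F s $$ (i, j)) \<in> B"
  using assms(2,3)
proof (induction S)
  case empty
  have "0 \<cdot>\<^sub>m 1\<^sub>m n \<in> B" using B by (auto simp: unital_subalgebra_def)
  moreover have "0 \<cdot>\<^sub>m 1\<^sub>m n = (mat n n (\<lambda>(i, j). 0) :: complex mat)" by (intro eq_matI) auto
  ultimately show ?case by (simp only: sum.empty)
next
  case (insert s S)
  let ?M = "mat n n (\<lambda>(i, j). \<Sum>s\<in>S. c s * F s $$ (i, j))"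
  have "F s \<in> carrier_mat n n" using insert B by (auto simp: unital_subalgebra_def)
  then have "mat n n (\<lambda>(i, j). \<Sum>s\<in>insert s S. c s * F s $$ (i, j)) = c s \<cdot>\<^sub>m F s + ?M"
    using insert by (intro eq_matI) auto
  moreover have "c s \<cdot>\<^sub>m F s + ?M \<in> B"
    using insert.IH insert.prems by (blast intro: unital_subalgebraD[OF B])
  ultimately show ?case by (simp only:)
qed

section \<open>The root stabilizer and its invariant matrices\<close>

lemma vertex_stabilizer_inv:
  assumes "\<sigma> \<in> vertex_stabilizer n E x0"
  shows "inv_into UNIV \<sigma> \<in> vertex_stabilizer n E x0"
proof -
  have p: "\<sigma> permutes {1..n}" and x0: "\<sigma> x0 = x0"
    and e: "\<And>x y. x \<in> {1..n} \<Longrightarrow> y \<in> {1..n} \<Longrightarrow> {\<sigma> x, \<sigma> y} \<in> E \<longleftrightarrow> {x, y} \<in> E"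
    using assms by (auto simp: vertex_stabilizer_def graph_automorphisms_def)
  have m: "inv_into UNIV \<sigma> x \<in> {1..n}" if "x \<in> {1..n}" for x
    using that permutes_in_image[OF permutes_inv[OF p], of x] by blast
  have "{inv_into UNIV \<sigma> x, inv_into UNIV \<sigma> y} \<in> E \<longleftrightarrow> {x, y} \<in> E" if "x \<in> {1..n}" "y \<in> {1..n}" for x y
    using e[OF m[OF that(1)] m[OF that(2)]] permutes_inverses(1)[OF p] by simp
  moreover have "inv_into UNIV \<sigma> x0 = x0" using permutes_inv_eq[OF p] x0 by blast
  ultimately show ?thesis
    using permutes_inv[OF p] by (auto simp: vertex_stabilizer_def graph_automorphisms_def)
qed

lemma T4_carrier: "M \<in> T4 n E x0 \<Longrightarrow> M \<in> carrier_mat n n"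
  by (simp add: T4_def)

lemma vertex_stabilizer_permutes: "\<sigma> \<in> vertex_stabilizer n E x0 \<Longrightarrow> \<sigma> permutes {1..n}"
  by (auto simp: vertex_stabilizer_def graph_automorphisms_def)

lemma vertex_stabilizer_mem: "\<sigma> \<in> vertex_stabilizer n E x0 \<Longrightarrow> x \<in> {1..n} \<Longrightarrow> \<sigma> x \<in> {1..n}"
  using permutes_in_image[OF vertex_stabilizer_permutes] by blast

lemma T4_entry: "M \<in> T4 n E x0 \<Longrightarrow> \<sigma> \<in> vertex_stabilizer n E x0 \<Longrightarrow> x \<in> {1..n} \<Longrightarrow> y \<in> {1..n} \<Longrightarrow>
    entry M (\<sigma> x) (\<sigma> y) = entry M x y"
  by (simp add: T4_def)

lemma unital_subalgebra_T4: "unital_subalgebra n (T4 n E x0)"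
proof -
  have mult: "M * N \<in> T4 n E x0" if M: "M \<in> T4 n E x0" and N: "N \<in> T4 n E x0" for M N
  proof -
    have "entry (M * N) (\<sigma> x) (\<sigma> y) = entry (M * N) x y"
      if s: "\<sigma> \<in> vertex_stabilizer n E x0" and x: "x \<in> {1..n}" and y: "y \<in> {1..n}" for \<sigma> x y
    proof -
      note m = vertex_stabilizer_mem[OF s]
      have "entry (M * N) (\<sigma> x) (\<sigma> y) = (\<Sum>z\<in>{1..n}. entry M (\<sigma> x) z * entry N z (\<sigma> y))"
        using entry_mult[OF T4_carrier[OF M] T4_carrier[OF N] m[OF x] m[OF y]] .
      \<comment> \<open>As \<sigma> permutes the vertices, the summation index may run over images;
        invariance of both factors then applies.\<close>
      also have "\<dots> = (\<Sum>z\<in>{1..n}. entry M (\<sigma> x) (\<sigma> z) * entry N (\<sigma> z) (\<sigma> y))"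
        by (rule sum.permute[OF vertex_stabilizer_permutes[OF s], unfolded o_def])
      also have "\<dots> = (\<Sum>z\<in>{1..n}. entry M x z * entry N z y)"
        using T4_entry[OF M s x] T4_entry[OF N s _ y] by (intro sum.cong) auto
      also have "\<dots> = entry (M * N) x y"
        using entry_mult[OF T4_carrier[OF M] T4_carrier[OF N] x y] by simp
      finally show ?thesis .
    qed
    then show ?thesis using T4_carrier[OF M] T4_carrier[OF N] by (auto simp: T4_def)
  qed
  have one: "1\<^sub>m n \<in> T4 n E x0"
    using vertex_stabilizer_mem inj_eq[OF permutes_inj[OF vertex_stabilizer_permutes]]
    by (simp add: T4_def entry_one del: atLeastAtMost_iff One_nat_def)
  have "M + N \<in> T4 n E x0" if "M \<in> T4 n E x0" "N \<in> T4 n E x0" for M N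
    using that[THEN T4_carrier] that[THEN T4_entry] vertex_stabilizer_mem
    by (simp add: T4_def entry_add[where n = n] del: atLeastAtMost_iff One_nat_def)
  moreover have "c \<cdot>\<^sub>m M \<in> T4 n E x0" if "M \<in> T4 n E x0" for M c
    using that[THEN T4_carrier] that[THEN T4_entry] vertex_stabilizer_mem
    by (simp add: T4_def entry_smult[where n = n] del: atLeastAtMost_iff One_nat_def)
  ultimately show ?thesis
    using mult one unfolding unital_subalgebra_def by (blast dest: T4_carrier)
qed

section \<open>The cycle seen from its root\<close>

locale rooted_cycle =
  fixes n x0 :: nat
  assumes n3: "n \<ge> 3" and x0: "x0 \<in> {1..n}"
begin

abbreviation V :: "nat set" where "V \<equiv> {1..n}"

abbreviation D :: nat where "D \<equiv> n div 2"

abbreviation dist0 :: "nat \<Rightarrow> nat" where "dist0 \<equiv> cycle_dist n x0"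

text \<open>The map \<open>2 * x0 - x\<close> modulo \<open>n\<close>, with representatives in
  \<open>V\<close>. It is the identity outside \<open>V\<close>, as \<open>permutes\<close>
  demands.\<close>

definition refl0 :: "nat \<Rightarrow> nat" where
  "refl0 x = (if x \<notin> V then x else if 2 * x0 \<le> x then 2 * x0 + n - x
     else if 2 * x0 - x \<le> n then 2 * x0 - x else 2 * x0 - x - n)"

text \<open>The vertex reached from the root by \<open>k\<close> upward steps around the cycle. For
  \<open>k \<le> D\<close> it is the chosen representative of the sphere of radius
  \<open>k\<close>.\<close>

definition arc :: "nat \<Rightarrow> nat" where
  "arc k = (if x0 + k \<le> n then x0 + k else x0 + k - n)"

text \<open>The congruence of \<open>x + refl0 x\<close> and \<open>2 * x0\<close> modulo
  \<open>n\<close> in linear form: both numbers lie between \<open>2\<close> and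
  \<open>2 * n\<close>, so they are equal or differ by \<open>n\<close>.\<close>

lemma refl0_cases:
  assumes "x \<in> V"
  shows "refl0 x \<in> V" "x + refl0 x = 2 * x0 \<or> x + refl0 x = 2 * x0 + n \<or> x + refl0 x + n = 2 * x0"
proof -
  consider "2 * x0 \<le> x" "refl0 x = 2 * x0 + n - x" | "x < 2 * x0" "2 * x0 - x \<le> n" "refl0 x = 2 * x0 - x"
    | "n < 2 * x0 - x" "refl0 x = 2 * x0 - x - n"
    using assms unfolding refl0_def by (meson not_le)
  then have "refl0 x \<in> V \<and>
    (x + refl0 x = 2 * x0 \<or> x + refl0 x = 2 * x0 + n \<or> x + refl0 x + n = 2 * x0)"
    using assms x0 unfolding atLeastAtMost_iff by cases linarith+
  then show "refl0 x \<in> V"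
    "x + refl0 x = 2 * x0 \<or> x + refl0 x = 2 * x0 + n \<or> x + refl0 x + n = 2 * x0" by auto
qed

lemmas refl0_mem = refl0_cases(1)

lemma refl0_eqI:
  assumes "x \<in> V" "y \<in> V" "x + y = 2 * x0 \<or> x + y = 2 * x0 + n \<or> x + y + n = 2 * x0"
  shows "refl0 x = y"
  using refl0_cases[OF assms(1)] assms unfolding atLeastAtMost_iff by linarith

lemma refl0_refl0 [simp]: "refl0 (refl0 x) = x"
proof (cases "x \<in> V")
  case True
  then show ?thesis using refl0_cases[OF True] by (intro refl0_eqI) (simp_all add: add.commute)
qed (simp add: refl0_def)

text \<open>Together with \<open>dist0_eqI\<close> this characterizes the distance as the only
  \<open>k\<close> with \<open>2 * k \<le> n\<close> and \<open>x\<close> congruent to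
  \<open>x0 + k\<close> or \<open>x0 - k\<close> modulo \<open>n\<close>, again in linear
  form.\<close>

lemma dist0_cases:
  assumes "x \<in> V"
  shows "2 * dist0 x \<le> n \<and> (x = x0 + dist0 x \<or> x + dist0 x = x0
    \<or> x + n = x0 + dist0 x \<or> x0 + n = x + dist0 x)"
proof (cases "x0 \<le> x")
  case True
  then obtain d where "x = x0 + d" by (auto simp: le_iff_add)
  then show ?thesis using assms x0 by (auto simp: cycle_dist_def min_def)
next
  case False
  then obtain d where "x0 = x + d" by (metis le_iff_add nat_le_linear)
  then show ?thesis using assms x0 False by (auto simp: cycle_dist_def min_def)
qed

lemma dist0_eqI:
  assumes "x \<in> V" "2 * k \<le> n" "x = x0 + k \<or> x + k = x0 \<or> x + n = x0 + k \<or> x0 + n = x + k"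
  shows "dist0 x = k"
  using dist0_cases[OF assms(1)] assms x0 unfolding atLeastAtMost_iff by (elim disjE conjE) linarith+

lemma dist0_refl0:
  assumes "x \<in> V"
  shows "dist0 (refl0 x) = dist0 x"
  using dist0_cases[OF assms] refl0_cases[OF assms] assms x0
  by (intro dist0_eqI) (simp_all, linarith)

lemma dist0_le: "x \<in> V \<Longrightarrow> dist0 x \<le> D"
  using dist0_cases by fastforce

text \<open>Both vertices are \<open>x0\<close> plus or minus the same number modulo
  \<open>n\<close>. Equal signs make them equal; opposite signs make \<open>x + y\<close> congruent
  to \<open>2 * x0\<close>.\<close>

lemma dist0_eqD:
  assumes "x \<in> V" "y \<in> V" "dist0 x = dist0 y"
  shows "x = y \<or> x = refl0 y"
proof (rule disjCI)
  assume "x \<noteq> refl0 y"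
  with refl0_eqI[OF assms(2,1)]
  have "\<not> (y + x = 2 * x0 \<or> y + x = 2 * x0 + n \<or> y + x + n = 2 * x0)" by blast
  then show "x = y"
    using dist0_cases[OF assms(1)] dist0_cases[OF assms(2)] assms x0
    unfolding atLeastAtMost_iff by (elim conjE disjE) linarith+
qed

lemma arc_cases: "arc k = x0 + k \<and> x0 + k \<le> n \<or> arc k + n = x0 + k \<and> n < x0 + k"
  unfolding arc_def by auto

lemma two_mult_le: "k \<le> D \<Longrightarrow> 2 * k \<le> n"
  by linarith

lemma arc_mem: "k \<le> D \<Longrightarrow> arc k \<in> V"
  using x0 arc_cases[of k] two_mult_le[of k] unfolding atLeastAtMost_iff by linarith

lemma dist0_arc [simp]: "k \<le> D \<Longrightarrow> dist0 (arc k) = k"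
  using arc_cases[of k] two_mult_le arc_mem by (intro dist0_eqI) auto

text \<open>The positions \<open>x0 + k\<close> and \<open>x0 - k\<close> agree modulo
  \<open>n\<close> exactly when \<open>n\<close> divides \<open>2 * k\<close>. As
  \<open>2 * k \<le> n\<close>, this leaves the root and, for even \<open>n\<close>, its
  antipode.\<close>

lemma refl0_fixed_iff:
  assumes "x \<in> V"
  shows "refl0 x = x \<longleftrightarrow> dist0 x = 0 \<or> 2 * dist0 x = n"
proof
  assume "refl0 x = x"
  then show "dist0 x = 0 \<or> 2 * dist0 x = n"
    using refl0_cases[OF assms] dist0_cases[OF assms] x0 assms unfolding atLeastAtMost_iff
    by (elim conjE disjE) linarith+
next
  assume "dist0 x = 0 \<or> 2 * dist0 x = n"
  then show "refl0 x = x"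
    using dist0_cases[OF assms] x0 assms unfolding atLeastAtMost_iff
    by (intro refl0_eqI assms) linarith
qed

lemma sphere_eq:
  assumes "x \<in> V"
  shows "{y \<in> V. dist0 y = dist0 x} = {x, refl0 x}"
  using dist0_eqD[OF _ assms] refl0_mem[OF assms] dist0_refl0[OF assms] assms by auto

section \<open>Edges under the reflection and between consecutive spheres\<close>

lemma edge_sym: "{x, y} \<in> cycle_edges n \<longleftrightarrow> {y, x} \<in> cycle_edges n"
  by (simp add: insert_commute)

text \<open>The reflection reverses the orientation of the cycle, so the successor of
  \<open>x\<close> goes to the predecessor of \<open>refl0 x\<close>, possibly wrapping from
  \<open>1\<close> to \<open>n\<close>.\<close>

lemma edge_refl0_Suc:
  assumes "x \<in> V" "x < n"
  shows "{refl0 x, refl0 (x + 1)} \<in> cycle_edges n"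
proof -
  have V: "refl0 x \<in> V" "refl0 (x + 1) \<in> V" using refl0_mem[OF assms(1)] refl0_mem[of "x + 1"] assms(2) by auto
  have "refl0 x = refl0 (x + 1) + 1 \<or> refl0 x = 1 \<and> refl0 (x + 1) = n"
    using refl0_cases(2)[OF assms(1)] refl0_cases(2)[of "x + 1"] V assms x0
    unfolding atLeastAtMost_iff by linarith
  then show ?thesis using V unfolding cycle_edges_iff[OF n3] by blast
qed

lemma edge_refl0_wrap: "{refl0 n, refl0 1} \<in> cycle_edges n"
proof -
  have V: "refl0 n \<in> V" "refl0 1 \<in> V" using n3 refl0_mem[of n] refl0_mem[of 1] by auto
  have "refl0 n = refl0 1 + 1 \<or> refl0 n = 1 \<and> refl0 1 = n"
    using refl0_cases(2)[of n] refl0_cases(2)[of 1] V n3 x0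
    unfolding atLeastAtMost_iff by linarith
  then show ?thesis using V unfolding cycle_edges_iff[OF n3] by blast
qed

lemma edge_refl0:
  assumes "{x, y} \<in> cycle_edges n"
  shows "{refl0 x, refl0 y} \<in> cycle_edges n"
proof -
  have "x \<in> V \<and> x < n \<and> y = x + 1 \<or> y \<in> V \<and> y < n \<and> x = y + 1 \<or> x = n \<and> y = 1 \<or> x = 1 \<and> y = n"
    using assms unfolding cycle_edges_iff[OF n3] by auto
  then show ?thesis
    using edge_refl0_Suc edge_refl0_wrap edge_sym by metis
qed

lemma edge_arc: "Suc k \<le> D \<Longrightarrow> {arc k, arc (Suc k)} \<in> cycle_edges n"
  using x0 unfolding cycle_edges_iff[OF n3] by (auto simp: arc_def)

text \<open>A crossing edge would join \<open>x0 + k\<close> to \<open>x0 - (k + 1)\<close>, whose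
  difference is \<open>2 * k + 1\<close>. This is \<open>1\<close> or \<open>-1\<close> modulo
  \<open>n\<close> only if \<open>n\<close> divides \<open>2 * k\<close> or
  \<open>2 * (k + 1)\<close>, and then one of the two arc vertices is fixed.\<close>

lemma edge_arc_refl0:
  assumes "Suc k \<le> D" "{arc k, refl0 (arc (Suc k))} \<in> cycle_edges n"
  shows "refl0 (arc k) = arc k \<or> refl0 (arc (Suc k)) = arc (Suc k)"
proof -
  define a b where "a = arc k" and "b = refl0 (arc (Suc k))"
  have b: "b \<in> V" "arc (Suc k) + b = 2 * x0 \<or> arc (Suc k) + b = 2 * x0 + n
      \<or> arc (Suc k) + b + n = 2 * x0"
    unfolding b_def using refl0_cases[OF arc_mem[OF assms(1)]] by blast+
  have "b = a + 1 \<or> a = b + 1 \<or> (a = n \<and> b = 1) \<or> (a = 1 \<and> b = n)"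
    using assms(2) unfolding cycle_edges_iff[OF n3] a_def b_def by blast
  then have e: "b = a + 1 \<or> a = b + 1 \<or> a + 1 = b + n \<or> b + 1 = a + n"
    using n3 by linarith
  have a: "a = x0 + k \<or> a + n = x0 + k"
    using arc_cases[of k] unfolding a_def by linarith
  have "arc (Suc k) = x0 + Suc k \<or> arc (Suc k) + n = x0 + Suc k"
    using arc_cases[of "Suc k"] by linarith
  \<comment> \<open>These are the possible forms of \<open>b\<close> being congruent to
    \<open>x0 - Suc k\<close>; the ranges of \<open>b\<close> and \<open>k\<close> exclude the first
    and the last.\<close>
  then have "b + Suc k + n = x0 \<or> b + Suc k = x0 \<or> b + Suc k = x0 + n \<or> b + Suc k = x0 + 2 * n"
    using b(2) by (elim disjE) linarith+
  moreover have "b + Suc k + n \<noteq> x0" "b + Suc k \<noteq> x0 + 2 * n"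
    using x0 b(1) two_mult_le[OF assms(1)] by auto
  ultimately have b': "b + Suc k = x0 \<or> b + Suc k = x0 + n"
    by blast
  have "\<not> (0 < k \<and> 2 * Suc k < n)"
  proof
    assume "0 < k \<and> 2 * Suc k < n"
    then show False using a b' e by auto
  qed
  then have "k = 0 \<or> 2 * Suc k = n"
    using two_mult_le[OF assms(1)] by linarith
  then show ?thesis
    using assms(1) refl0_fixed_iff[OF arc_mem[of k]] refl0_fixed_iff[OF arc_mem[of "Suc k"]]
      dist0_arc[of k] dist0_arc[of "Suc k"] Suc_leD[OF assms(1)] by metis
qed

text \<open>If a crossing pair is an edge, \<open>edge_arc_refl0\<close> gives a fixed endpoint, and
  the pair coincides with the arc edge or its mirror image.\<close>

lemma edge_arc_iff:
  assumes "Suc k \<le> D" "x \<in> V" "y \<in> V" "dist0 x = k" "dist0 y = Suc k"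
  shows "{x, y} \<in> cycle_edges n \<longleftrightarrow>
    x = arc k \<and> y = arc (Suc k) \<or> x = refl0 (arc k) \<and> y = refl0 (arc (Suc k))"
proof -
  let ?a = "arc k" and ?b = "arc (Suc k)"
  have V: "?a \<in> V" "?b \<in> V" using arc_mem[of k] arc_mem[of "Suc k"] assms(1) by linarith+
  have xy: "x = ?a \<or> x = refl0 ?a" "y = ?b \<or> y = refl0 ?b"
    using dist0_eqD[OF assms(2) V(1)] dist0_eqD[OF assms(3) V(2)] assms by simp_all
  have e: "{?a, ?b} \<in> cycle_edges n" "{refl0 ?a, refl0 ?b} \<in> cycle_edges n"
    using edge_arc edge_refl0 assms(1) by blast+
  have "refl0 ?a = ?a \<or> refl0 ?b = ?b" if "{refl0 ?a, ?b} \<in> cycle_edges n"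
    using edge_refl0[OF that] edge_arc_refl0[OF assms(1)] by simp
  then show ?thesis
    using xy e edge_arc_refl0[OF assms(1)] by metis
qed

section \<open>The generated algebra\<close>

abbreviation E :: "nat set set" where "E \<equiv> cycle_edges n"

abbreviation G :: "(nat \<Rightarrow> nat) set" where "G \<equiv> vertex_stabilizer n E x0"

lemma refl0_stabilizer: "refl0 \<in> G"
proof -
  have "refl0 permutes V"
    unfolding permutes_def using refl0_refl0 by (metis refl0_def)
  moreover have "{refl0 x, refl0 y} \<in> E \<longleftrightarrow> {x, y} \<in> E" for x y
    using edge_refl0[of x y] edge_refl0[of "refl0 x" "refl0 y"] by auto
  moreover have "refl0 x0 = x0"
    using x0 by (intro refl0_eqI) auto
  ultimately show ?thesis by (simp add: vertex_stabilizer_def graph_automorphisms_def)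
qed

text \<open>An automorphism fixing the root maps walks from the root to such walks, so it does not
  increase the distance. Its inverse gives the other inequality.\<close>

lemma dist0_stabilizer:
  assumes "\<sigma> \<in> G" "x \<in> V"
  shows "dist0 (\<sigma> x) = dist0 x"
proof -
  have le: "dist0 (\<tau> y) \<le> dist0 y" if t: "\<tau> \<in> G" and y: "y \<in> V" for \<tau> y
  proof -
    have "{\<tau> u, \<tau> v} \<in> E" if "{u, v} \<in> E" for u v
    proof -
      have "u \<in> V" "v \<in> V" using that unfolding cycle_edges_iff[OF n3] by auto
      then show ?thesis using t that by (simp add: vertex_stabilizer_def graph_automorphisms_def)
    qed
    from walk_map[of E \<tau>, OF this cycle_dist_walk[OF n3 x0 y refl]]
    show ?thesis
      using t cycle_dist_le_walk[OF n3 x0] by (simp add: vertex_stabilizer_def)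
  qed
  have "inv_into UNIV \<sigma> (\<sigma> x) = x"
    using permutes_inverses(2)[OF vertex_stabilizer_permutes[OF assms(1)]] by simp
  then show ?thesis
    using le[OF assms] le[OF vertex_stabilizer_inv[OF assms(1)] vertex_stabilizer_mem[OF assms]] by simp
qed

section \<open>Stabilizer orbits as spheres\<close>

lemma sphere_at_eq: "sphere_at n E x0 k = {x \<in> V. dist0 x = k}"
  using graph_dist_cycle[OF n3 x0] by (auto simp: sphere_at_def)

text \<open>The identity and the reflection already reach both vertices of the sphere, and no
  element of the stabilizer leaves it.\<close>

lemma orbit_eq:
  assumes "x \<in> V"
  shows "{\<sigma> x |\<sigma>. \<sigma> \<in> G} = {y \<in> V. dist0 y = dist0 x}"
proof -
  have "id \<in> G" by (simp add: vertex_stabilizer_def graph_automorphisms_def permutes_id)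
  then have "id x \<in> {\<sigma> x |\<sigma>. \<sigma> \<in> G}" by blast
  then have "x \<in> {\<sigma> x |\<sigma>. \<sigma> \<in> G}" by (simp only: id_apply)
  moreover have "refl0 x \<in> {\<sigma> x |\<sigma>. \<sigma> \<in> G}" using refl0_stabilizer by blast
  ultimately have "{y \<in> V. dist0 y = dist0 x} \<subseteq> {\<sigma> x |\<sigma>. \<sigma> \<in> G}"
    unfolding sphere_eq[OF assms] by blast
  then show ?thesis
    using dist0_stabilizer vertex_stabilizer_mem assms by blast
qed

lemma stabilizer_orbits_eq: "stabilizer_orbits n E x0 = {sphere_at n E x0 k | k. k \<le> eccentricity n E x0}"
  (is "?L = ?R")
proof
  show "?L \<subseteq> ?R"
  proof
    fix Y assume "Y \<in> ?L"
    then obtain x where x: "x \<in> V" "Y = {\<sigma> x |\<sigma>. \<sigma> \<in> G}" unfolding stabilizer_orbits_def by blast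
    then have "Y = sphere_at n E x0 (dist0 x)" using orbit_eq[OF x(1)] by (simp add: sphere_at_eq)
    then show "Y \<in> ?R" unfolding eccentricity_cycle[OF n3 x0] using dist0_le[OF x(1)] by blast
  qed
  show "?R \<subseteq> ?L"
  proof
    fix Y assume "Y \<in> ?R"
    then obtain k where k: "k \<le> D" "Y = sphere_at n E x0 k"
      unfolding eccentricity_cycle[OF n3 x0] by blast
    \<comment> \<open>The vertex \<open>arc k\<close> shows that the sphere is nonempty, and its
      orbit is the whole sphere.\<close>
    then have "Y = {\<sigma> (arc k) |\<sigma>. \<sigma> \<in> G}"
      using orbit_eq[OF arc_mem[OF k(1)]] by (simp add: sphere_at_eq)
    then show "Y \<in> ?L" unfolding stabilizer_orbits_def using arc_mem[OF k(1)] by blast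
  qed
qed

lemma T2_eq_T3: "T2 n E x0 = T3 n E x0"
  unfolding T2_def T3_def stabilizer_orbits_eq
  by (rule arg_cong[where f = "generated_algebra n"]) blast

text \<open>As \<open>T4\<close> is a unital subalgebra, only the generators need checking:
  automorphisms preserve adjacency, and those fixing the root preserve the spheres.\<close>

lemma T2_subset_T4: "T2 n E x0 \<subseteq> T4 n E x0"
  unfolding T2_def generated_algebra_def
proof (rule hull_minimal)
  have "adjacency_matrix n E \<in> T4 n E x0"
    using vertex_stabilizer_mem
    by (auto simp: T4_def entry_adjacency_matrix vertex_stabilizer_def graph_automorphisms_def
        simp del: atLeastAtMost_iff One_nat_def)
  moreover have "diag_idem n (sphere_at n E x0 k) \<in> T4 n E x0" for k
    using vertex_stabilizer_mem inj_eq[OF permutes_inj[OF vertex_stabilizer_permutes]] dist0_stabilizer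
    by (simp add: T4_def entry_diag_idem sphere_at_eq del: atLeastAtMost_iff One_nat_def)
  ultimately show "{adjacency_matrix n E} \<union>
      {diag_idem n (sphere_at n E x0 k) |k. k \<le> eccentricity n E x0} \<subseteq> T4 n E x0"
    by blast
qed (rule unital_subalgebra_T4)

lemma unital_subalgebra_T2: "unital_subalgebra n (T2 n E x0)"
  unfolding T2_def by (rule unital_subalgebra_generated_algebra) auto

lemma adjacency_in_T2: "adjacency_matrix n E \<in> T2 n E x0"
  unfolding T2_def generated_algebra_def by (rule hull_inc) simp

lemma sphere_idem_in_T2: "k \<le> D \<Longrightarrow> diag_idem n {x \<in> V. dist0 x = k} \<in> T2 n E x0"
  unfolding T2_def generated_algebra_def
  by (rule hull_inc) (use eccentricity_cycle[OF n3 x0] sphere_at_eq in auto)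

text \<open>A pair of fixed vertices is counted twice.\<close>

definition orbit_mat :: "nat \<Rightarrow> nat \<Rightarrow> complex mat" where
  "orbit_mat x y = mat n n (\<lambda>(i, j).
     of_bool (i + 1 = x \<and> j + 1 = y) + of_bool (i + 1 = refl0 x \<and> j + 1 = refl0 y))"

lemma orbit_mat_carrier [simp]: "orbit_mat x y \<in> carrier_mat n n"
  by (simp add: orbit_mat_def)

lemma entry_orbit_mat: "u \<in> V \<Longrightarrow> v \<in> V \<Longrightarrow>
    entry (orbit_mat x y) u v = of_bool (u = x \<and> v = y) + of_bool (u = refl0 x \<and> v = refl0 y)"
  by (simp add: orbit_mat_def)

lemma orbit_mat_refl0: "orbit_mat (refl0 x) (refl0 y) = orbit_mat x y"
  by (rule mat_eqI_entry[of _ n]) (auto simp: entry_orbit_mat)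

lemma entry_orbit_mat_mult:
  assumes "y \<in> V" "u \<in> V" "v \<in> V"
  shows "entry (orbit_mat x y * orbit_mat y z) u v =
    of_bool (u = x) * entry (orbit_mat y z) y v + of_bool (u = refl0 x) * entry (orbit_mat y z) (refl0 y) v"
proof -
  \<comment> \<open>The two indicator terms stay separate, since both contribute at the same index
    when \<open>y\<close> is fixed.\<close>
  have "entry (orbit_mat x y * orbit_mat y z) u v =
      (\<Sum>w\<in>V. (if w = y then of_bool (u = x) * entry (orbit_mat y z) y v else 0) +
         (if w = refl0 y then of_bool (u = refl0 x) * entry (orbit_mat y z) (refl0 y) v else 0))"
    unfolding entry_mult[OF orbit_mat_carrier orbit_mat_carrier assms(2,3)]
    using assms by (intro sum.cong refl) (auto simp: entry_orbit_mat[OF assms(2)])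
  then show ?thesis
    using assms refl0_mem[OF assms(1)] by (simp add: sum.distrib)
qed

lemma orbit_mat_mult_carrier [simp]: "orbit_mat x y * orbit_mat z w \<in> carrier_mat n n"
  by (rule mult_carrier_mat[OF orbit_mat_carrier orbit_mat_carrier])

text \<open>The cross terms of the product would match \<open>y\<close> with its mirror image, so
  they vanish.\<close>

lemma orbit_mat_mult:
  assumes "y \<in> V" "refl0 y \<noteq> y"
  shows "orbit_mat x y * orbit_mat y z = orbit_mat x z"
  by (rule mat_eqI_entry[of _ n])
    (use assms refl0_mem[OF assms(1)] in \<open>auto simp: entry_orbit_mat_mult entry_orbit_mat simp del: atLeastAtMost_iff One_nat_def\<close>)

text \<open>At a fixed middle vertex the cross terms survive and link \<open>x\<close> to the mirror
  image of \<open>z\<close> as well. This is what permits changing sides at the root.\<close>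

lemma orbit_mat_mult_fixed:
  assumes "y \<in> V" "refl0 y = y"
  shows "orbit_mat x y * orbit_mat y z = orbit_mat x z + orbit_mat x (refl0 z)"
  by (rule mat_eqI_entry[of _ n])
    (use assms in \<open>simp_all add: entry_orbit_mat_mult entry_orbit_mat entry_add[where n = n] of_bool_conj
      algebra_simps del: atLeastAtMost_iff One_nat_def\<close>)

section \<open>Orbit matrices inside the generated algebra\<close>

abbreviation sphere :: "nat \<Rightarrow> nat set" where "sphere k \<equiv> {x \<in> V. dist0 x = k}"

lemma T2_mult: "M \<in> T2 n E x0 \<Longrightarrow> N \<in> T2 n E x0 \<Longrightarrow> M * N \<in> T2 n E x0"
  by (rule unital_subalgebraD(4)[OF unital_subalgebra_T2])

lemma sphere_block_carrier:
  "M \<in> carrier_mat n n \<Longrightarrow> diag_idem n Y * M * diag_idem n Z \<in> carrier_mat n n"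
  by (rule mult_carrier_mat[OF mult_carrier_mat[OF diag_idem_carrier] diag_idem_carrier])

lemma entry_sphere_block:
  assumes "M \<in> carrier_mat n n" "x \<in> V" "y \<in> V"
  shows "entry (diag_idem n (sphere k) * M * diag_idem n (sphere l)) x y =
    (if dist0 x = k \<and> dist0 y = l then entry M x y else 0)"
  using assms by (simp add: entry_diag_idem_mult[OF mult_carrier_mat[OF diag_idem_carrier]]
      entry_diag_idem_mult[OF assms] del: atLeastAtMost_iff One_nat_def)

lemma orbit_mat_diag_in_T2:
  assumes "x \<in> V"
  shows "orbit_mat x x \<in> T2 n E x0"
proof -
  have m: "y \<in> sphere (dist0 x) \<longleftrightarrow> y = x \<or> y = refl0 x" for y
    unfolding sphere_eq[OF assms] by blast
  \<comment> \<open>The factor \<open>2\<close> occurs at a fixed vertex, where the two matrix units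
    coincide.\<close>
  have "orbit_mat x x = (if refl0 x = x then 2 else 1) \<cdot>\<^sub>m diag_idem n (sphere (dist0 x))"
    by (rule mat_eqI_entry[of _ n])
      (auto simp: entry_orbit_mat entry_diag_idem m entry_smult[where n = n]
        simp del: atLeastAtMost_iff One_nat_def mem_Collect_eq)
  then show ?thesis
    using unital_subalgebraD(5)[OF unital_subalgebra_T2 sphere_idem_in_T2[OF dist0_le[OF assms]]] by simp
qed

text \<open>Fixed vertices have distance \<open>0\<close> or half of \<open>n\<close>; these are
  consecutive only for \<open>n = 2\<close>.\<close>

lemma refl0_arc_cases:
  assumes "Suc k \<le> D"
  shows "refl0 (arc k) \<noteq> arc k \<or> refl0 (arc (Suc k)) \<noteq> arc (Suc k)"
  using refl0_fixed_iff[OF arc_mem[of k]] refl0_fixed_iff[OF arc_mem[of "Suc k"]] assms n3 by auto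

lemma refl0_arc_ne: "0 < k \<Longrightarrow> k < D \<Longrightarrow> refl0 (arc k) \<noteq> arc k"
  using refl0_fixed_iff[OF arc_mem[of k]] by auto

lemma refl0_arc_1: "refl0 (arc 1) \<noteq> arc 1"
  using refl0_fixed_iff[OF arc_mem[of 1]] dist0_arc[of 1] n3 by auto

text \<open>Between consecutive spheres the adjacency matrix has only the arc edge and its mirror
  image, so the block cut out by two sphere projections is an orbit matrix.\<close>

lemma orbit_mat_step_in_T2:
  assumes "Suc k \<le> D"
  shows "orbit_mat (arc k) (arc (Suc k)) \<in> T2 n E x0" "orbit_mat (arc (Suc k)) (arc k) \<in> T2 n E x0"
proof -
  let ?a = "arc k" and ?b = "arc (Suc k)" and ?A = "adjacency_matrix n E"
  have V: "?a \<in> V" "?b \<in> V" "refl0 ?a \<in> V" "refl0 ?b \<in> V"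
    using arc_mem[of k] arc_mem[of "Suc k"] refl0_mem[of ?a] refl0_mem[of ?b] assms by (metis Suc_leD)+
  have d: "dist0 ?a = k" "dist0 ?b = Suc k" "dist0 (refl0 ?a) = k" "dist0 (refl0 ?b) = Suc k"
    using assms dist0_refl0[OF V(1)] dist0_refl0[OF V(2)] by simp_all
  \<comment> \<open>The two summands are never both \<open>1\<close>, by
    \<open>refl0_arc_cases\<close>, so the sum matches the 0/1 entries of the adjacency
    matrix.\<close>
  have e: "of_bool (u = ?a \<and> v = ?b) + of_bool (u = refl0 ?a \<and> v = refl0 ?b) =
      (if dist0 u = k \<and> dist0 v = Suc k then if {u, v} \<in> E then 1 else 0 else 0 :: complex)"
    if "u \<in> V" "v \<in> V" for u v
    using edge_arc_iff[OF assms that] refl0_arc_cases[OF assms] d by auto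
  have "orbit_mat ?a ?b = diag_idem n (sphere k) * ?A * diag_idem n (sphere (Suc k))"
  proof (rule mat_eqI_entry[of _ n])
    fix u v assume uv: "u \<in> V" "v \<in> V"
    show "entry (orbit_mat ?a ?b) u v = entry (diag_idem n (sphere k) * ?A * diag_idem n (sphere (Suc k))) u v"
      unfolding entry_orbit_mat[OF uv] e[OF uv] entry_sphere_block[OF adjacency_matrix_carrier uv]
        entry_adjacency_matrix[OF uv] by simp
  qed (simp_all add: sphere_block_carrier)
  then show "orbit_mat ?a ?b \<in> T2 n E x0"
    using T2_mult sphere_idem_in_T2[of k] sphere_idem_in_T2[of "Suc k"] adjacency_in_T2 assms by simp
  have "orbit_mat ?b ?a = diag_idem n (sphere (Suc k)) * ?A * diag_idem n (sphere k)"
  proof (rule mat_eqI_entry[of _ n])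
    fix u v assume uv: "u \<in> V" "v \<in> V"
    have "entry (orbit_mat ?b ?a) u v = of_bool (v = ?a \<and> u = ?b) + of_bool (v = refl0 ?a \<and> u = refl0 ?b)"
      unfolding entry_orbit_mat[OF uv] by (simp add: conj_commute)
    then show "entry (orbit_mat ?b ?a) u v = entry (diag_idem n (sphere (Suc k)) * ?A * diag_idem n (sphere k)) u v"
      unfolding e[OF uv(2,1)] entry_sphere_block[OF adjacency_matrix_carrier uv]
        entry_adjacency_matrix[OF uv] edge_sym[of v u] by simp
  qed (simp_all add: sphere_block_carrier)
  then show "orbit_mat ?b ?a \<in> T2 n E x0"
    using T2_mult sphere_idem_in_T2[of k] sphere_idem_in_T2[of "Suc k"] adjacency_in_T2 assms by simp
qed

lemma orbit_mat_arcs_le_in_T2: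
  assumes "k \<le> l" "l \<le> D"
  shows "orbit_mat (arc k) (arc l) \<in> T2 n E x0 \<and> orbit_mat (arc l) (arc k) \<in> T2 n E x0"
  using assms
proof (induction l rule: dec_induct)
  case base
  then show ?case using orbit_mat_diag_in_T2 arc_mem by blast
next
  case (step l)
  show ?case
  proof (cases "k = l")
    case True
    then show ?thesis using orbit_mat_step_in_T2 step.prems by blast
  next
    case False
    \<comment> \<open>Here \<open>0 < l < D\<close>, so the middle vertex is not fixed and
      \<open>orbit_mat_mult\<close> applies. The case \<open>k = l\<close> is split off because
      \<open>arc 0\<close> is fixed.\<close>
    then have l: "arc l \<in> V" "refl0 (arc l) \<noteq> arc l"
      using step refl0_arc_ne[of l] arc_mem[of l] by auto
    have "orbit_mat (arc k) (arc l) * orbit_mat (arc l) (arc (Suc l)) \<in> T2 n E x0"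
      "orbit_mat (arc (Suc l)) (arc l) * orbit_mat (arc l) (arc k) \<in> T2 n E x0"
      using T2_mult orbit_mat_step_in_T2[OF step.prems] step.IH step.prems by auto
    then show ?thesis unfolding orbit_mat_mult[OF l] by blast
  qed
qed

lemma orbit_mat_arc_arc_in_T2: "k \<le> D \<Longrightarrow> l \<le> D \<Longrightarrow> orbit_mat (arc k) (arc l) \<in> T2 n E x0"
  using orbit_mat_arcs_le_in_T2 nat_le_linear by metis

text \<open>By \<open>orbit_mat_mult_fixed\<close>, the round trip through the root links
  \<open>arc 1\<close> both to itself and to its mirror image; the first link is subtracted.\<close>

lemma orbit_mat_swap_in_T2: "orbit_mat (arc 1) (refl0 (arc 1)) \<in> T2 n E x0"
proof -
  have D: "Suc 0 \<le> D" using n3 by linarith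
  have V: "arc 0 \<in> V" "arc 1 \<in> V" using D arc_mem by auto
  have fixed: "refl0 (arc 0) = arc 0" using refl0_fixed_iff[OF V(1)] by simp
  have "orbit_mat (arc 1) (refl0 (arc 1)) = orbit_mat (arc 1) (arc 0) * orbit_mat (arc 0) (arc 1) - orbit_mat (arc 1) (arc 1)"
    unfolding orbit_mat_mult_fixed[OF V(1) fixed]
    by (rule mat_eqI_entry[of _ n])
      (auto simp: entry_minus[where n = n] entry_add[where n = n] minus_carrier_mat
        simp del: atLeastAtMost_iff One_nat_def)
  moreover have "orbit_mat (arc 1) (arc 0) * orbit_mat (arc 0) (arc 1) \<in> T2 n E x0"
    using T2_mult orbit_mat_step_in_T2[OF D] by simp
  ultimately show ?thesis
    using unital_subalgebra_minus[OF unital_subalgebra_T2] orbit_mat_diag_in_T2[OF V(2)] by metis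
qed

lemma orbit_mat_arc_refl0_in_T2:
  assumes "k \<le> D" "l \<le> D"
  shows "orbit_mat (arc k) (refl0 (arc l)) \<in> T2 n E x0"
proof -
  note T = orbit_mat_arc_arc_in_T2
  have D: "1 \<le> D" using n3 by linarith
  let ?c = "arc 1"
  have c: "?c \<in> V" "refl0 ?c \<noteq> ?c" "refl0 ?c \<in> V" "refl0 (refl0 ?c) \<noteq> refl0 ?c"
    using arc_mem[OF D] refl0_arc_1 refl0_mem[OF arc_mem[OF D]] by auto
  \<comment> \<open>The route leads from \<open>arc k\<close> to distance one, changes sides there,
    and follows the mirrored arc. The last factor equals \<open>orbit_mat ?c (arc l)\<close> by
    \<open>orbit_mat_refl0\<close>.\<close>
  have "orbit_mat (arc k) ?c * orbit_mat ?c (refl0 ?c) * orbit_mat (refl0 ?c) (refl0 (arc l)) \<in> T2 n E x0"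
    unfolding orbit_mat_refl0 using T2_mult T[OF assms(1) D] T[OF D assms(2)] orbit_mat_swap_in_T2 by blast
  then show ?thesis
    by (simp only: orbit_mat_mult[OF c(1,2)] orbit_mat_mult[OF c(3,4)])
qed

lemma vertex_cases:
  assumes "x \<in> V"
  obtains k where "k \<le> D" "x = arc k" | k where "k \<le> D" "x = refl0 (arc k)"
  using dist0_eqD[OF assms arc_mem[OF dist0_le[OF assms]]] dist0_le[OF assms] dist0_arc by metis

lemma orbit_mat_in_T2:
  assumes "x \<in> V" "y \<in> V"
  shows "orbit_mat x y \<in> T2 n E x0"
  using assms(1)
proof (cases rule: vertex_cases)
  case (1 k)
  show ?thesis using assms(2)
    by (cases rule: vertex_cases) (use 1 orbit_mat_arc_arc_in_T2 orbit_mat_arc_refl0_in_T2 in auto)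
next
  case (2 k)
  \<comment> \<open>Reflecting both indices keeps the orbit matrix and moves \<open>x\<close> onto
    the arc.\<close>
  have "orbit_mat (refl0 x) (refl0 y) \<in> T2 n E x0" using assms(2)
    by (cases rule: vertex_cases) (use 2 orbit_mat_arc_arc_in_T2 orbit_mat_arc_refl0_in_T2 in auto)
  then show ?thesis by (simp only: orbit_mat_refl0)
qed

text \<open>\<open>M\<close> is half the sum of \<open>entry M x y\<close> times
  \<open>orbit_mat x y\<close> over all pairs: each entry is reached from its own pair and from the
  mirror pair, or twice from a fixed pair.\<close>

lemma refl0_invariant_in_T2:
  assumes M: "M \<in> carrier_mat n n"
    and inv: "\<And>x y. x \<in> V \<Longrightarrow> y \<in> V \<Longrightarrow> entry M (refl0 x) (refl0 y) = entry M x y"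
  shows "M \<in> T2 n E x0"
proof -
  let ?c = "\<lambda>(x, y). entry M x y / 2" and ?F = "\<lambda>(x, y). orbit_mat x y"
  let ?N = "mat n n (\<lambda>(i, j). \<Sum>s\<in>V \<times> V. ?c s * ?F s $$ (i, j))"
  have "?N \<in> T2 n E x0"
    by (rule unital_subalgebra_sum[OF unital_subalgebra_T2]) (auto simp: orbit_mat_in_T2 simp del: atLeastAtMost_iff)
  moreover have "?N = M"
  proof (rule mat_eqI_entry[of _ n])
    fix u v assume uv: "u \<in> V" "v \<in> V"
    note uv' = refl0_mem[OF uv(1)] refl0_mem[OF uv(2)]
    have "u = a \<and> v = b \<longleftrightarrow> (a, b) = (u, v)"
      "u = refl0 a \<and> v = refl0 b \<longleftrightarrow> (a, b) = (refl0 u, refl0 v)" for a b by auto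
    then have F: "entry (?F s) u v = of_bool (s = (u, v)) + of_bool (s = (refl0 u, refl0 v))" for s
      unfolding case_prod_unfold entry_orbit_mat[OF uv] by (simp only: prod.collapse)
    have "entry ?N u v = (\<Sum>s\<in>V \<times> V. ?c s * entry (?F s) u v)"
    proof -
      have "u - 1 < n" "v - 1 < n" using uv by auto
      then show ?thesis unfolding entry_def by simp
    qed
    also have "\<dots> = (\<Sum>s\<in>V \<times> V. (if s = (u, v) then ?c s else 0) + (if s = (refl0 u, refl0 v) then ?c s else 0))"
      unfolding F by (intro sum.cong refl) (simp add: distrib_left)
    also have "\<dots> = ?c (u, v) + ?c (refl0 u, refl0 v)"
      unfolding sum.distrib using uv uv' by simp
    also have "\<dots> = entry M u v" using inv[OF uv] by simp
    finally show "entry ?N u v = entry M u v" .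
  qed (use M in auto)
  ultimately show ?thesis by simp
qed

text \<open>Invariance under the reflection alone puts a matrix into \<open>T2\<close>, hence into
  \<open>T4\<close>, which closes the circle of inclusions.\<close>

lemma T4_eq_refl0_invariant:
  "T4 n E x0 = {M \<in> carrier_mat n n. \<forall>x\<in>V. \<forall>y\<in>V. entry M (refl0 x) (refl0 y) = entry M x y}"
  using T2_subset_T4 refl0_invariant_in_T2 refl0_stabilizer unfolding T4_def by blast

lemma T2_eq_T4: "T2 n E x0 = T4 n E x0"
  using T2_subset_T4 refl0_invariant_in_T2 unfolding T4_eq_refl0_invariant by blast

section \<open>The block decomposition\<close>

text \<open>The number of spheres with two vertices, which are those of radius \<open>1\<close> to
  \<open>m\<close>.\<close>

abbreviation m :: nat where "m \<equiv> n - D - 1"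

text \<open>The restrictions of this function to the spheres of radius \<open>1\<close> to
  \<open>m\<close> form a basis of the antisymmetric vectors.\<close>

definition sgn0 :: "nat \<Rightarrow> complex" where
  "sgn0 x = (if refl0 x = x then 0 else if x = arc (dist0 x) then 1 else -1)"

text \<open>The value at \<open>arc k\<close> of \<open>M\<close> applied to the restriction of
  \<chi> to the sphere of radius \<open>l\<close>. The constant \<chi> serves the symmetric vectors,
  \<open>sgn0\<close> the antisymmetric ones.\<close>

definition twist :: "(nat \<Rightarrow> complex) \<Rightarrow> complex mat \<Rightarrow> nat \<Rightarrow> nat \<Rightarrow> complex" where
  "twist \<chi> M k l = (\<Sum>y\<in>sphere l. \<chi> y * entry M (arc k) y)"

lemma not_fixed_iff: "x \<in> V \<Longrightarrow> refl0 x \<noteq> x \<longleftrightarrow> dist0 x \<in> {1..m}"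
  unfolding refl0_fixed_iff using dist0_le[of x] by auto

lemma sgn0_refl0:
  assumes "x \<in> V"
  shows "sgn0 (refl0 x) = - sgn0 x"
proof -
  have "x = arc (dist0 x) \<or> x = refl0 (arc (dist0 x))"
    using dist0_eqD[OF assms arc_mem[OF dist0_le[OF assms]]] dist0_le[OF assms] by simp
  then show ?thesis
    unfolding sgn0_def dist0_refl0[OF assms] using refl0_refl0 by (smt (verit) minus_zero minus_minus)
qed

lemma sum_sphere_refl0: "(\<Sum>y\<in>sphere l. f (refl0 y)) = (\<Sum>y\<in>sphere l. f y)"
  by (rule sum.reindex_bij_witness[where i = refl0 and j = refl0])
    (auto simp: dist0_refl0 refl0_mem simp del: atLeastAtMost_iff One_nat_def)

text \<open>Orthogonality of symmetric and antisymmetric vectors on a sphere: reflecting the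
  summation index negates the sum.\<close>

lemma sum_sphere_sgn0: "(\<Sum>y\<in>sphere l. sgn0 y) = 0"
proof -
  have "(\<Sum>y\<in>sphere l. sgn0 y) = (\<Sum>y\<in>sphere l. sgn0 (refl0 y))"
    by (rule sum_sphere_refl0[symmetric])
  also have "\<dots> = - (\<Sum>y\<in>sphere l. sgn0 y)"
    unfolding sum_negf[symmetric] by (intro sum.cong refl sgn0_refl0) simp
  finally show ?thesis by simp
qed

lemma sgn0_arc: "k \<le> D \<Longrightarrow> sgn0 (arc k) = of_bool (k \<in> {1..m})"
  using not_fixed_iff[OF arc_mem[of k]] by (auto simp: sgn0_def)

lemma sgn0_eq_0: "x \<in> V \<Longrightarrow> dist0 x \<notin> {1..m} \<Longrightarrow> sgn0 x = 0"
  using not_fixed_iff[of x] by (simp add: sgn0_def)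

lemma sgn0_square: "x \<in> V \<Longrightarrow> dist0 x \<in> {1..m} \<Longrightarrow> sgn0 x * sgn0 x = 1"
  using not_fixed_iff[of x] by (simp add: sgn0_def)

lemma twist_sgn0_eq_0: "l \<notin> {1..m} \<Longrightarrow> twist sgn0 M k l = 0"
  unfolding twist_def by (rule sum.neutral) (auto simp: sgn0_eq_0)

text \<open>\<open>N\<close> maps the restriction of \<chi> to a sphere to a vector that is a
  multiple of \<chi> on every sphere, so the span of these restrictions is preserved.\<close>

definition equivariant :: "(nat \<Rightarrow> complex) \<Rightarrow> complex mat \<Rightarrow> bool" where
  "equivariant \<chi> N \<longleftrightarrow>
    (\<forall>z\<in>V. \<forall>l. (\<Sum>y\<in>sphere l. \<chi> y * entry N z y) = \<chi> z * twist \<chi> N (dist0 z) l)"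

lemma T4_refl0: "N \<in> T4 n E x0 \<Longrightarrow> x \<in> V \<Longrightarrow> y \<in> V \<Longrightarrow> entry N (refl0 x) (refl0 y) = entry N x y"
  unfolding T4_eq_refl0_invariant by blast

text \<open>Invariance moves the reflection from the row index to the weight \<chi>.\<close>

lemma sum_sphere_entry_refl0:
  assumes "N \<in> T4 n E x0" "z \<in> V"
  shows "(\<Sum>y\<in>sphere l. \<chi> y * entry N (refl0 z) y) = (\<Sum>y\<in>sphere l. \<chi> (refl0 y) * entry N z y)"
proof -
  have "(\<Sum>y\<in>sphere l. \<chi> y * entry N (refl0 z) y) = (\<Sum>y\<in>sphere l. \<chi> (refl0 y) * entry N (refl0 z) (refl0 y))"
    by (rule sum_sphere_refl0[symmetric])
  then show ?thesis using T4_refl0[OF assms] by simp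
qed

lemma equivariant_one:
  assumes "N \<in> T4 n E x0"
  shows "equivariant (\<lambda>_. 1) N"
  unfolding equivariant_def
proof (intro ballI allI)
  fix z l assume "z \<in> V"
  then show "(\<Sum>y\<in>sphere l. 1 * entry N z y) = 1 * twist (\<lambda>_. 1) N (dist0 z) l"
  proof (cases rule: vertex_cases)
    case (2 k)
    then show ?thesis
      using sum_sphere_entry_refl0[OF assms arc_mem[OF 2(1)], of "\<lambda>_. 1"] dist0_refl0[OF arc_mem[OF 2(1)]]
      by (simp add: twist_def)
  qed (simp add: twist_def)
qed

lemma equivariant_sgn0:
  assumes "N \<in> T4 n E x0"
  shows "equivariant sgn0 N"
  unfolding equivariant_def
proof (intro ballI allI)
  fix z l assume z: "z \<in> V"
  have neg: "(\<Sum>y\<in>sphere l. sgn0 y * entry N (refl0 x) y) = - (\<Sum>y\<in>sphere l. sgn0 y * entry N x y)"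
    if "x \<in> V" for x
    unfolding sum_sphere_entry_refl0[OF assms that] sum_negf[symmetric]
    by (intro sum.cong refl) (simp add: sgn0_refl0 del: atLeastAtMost_iff One_nat_def)
  show "(\<Sum>y\<in>sphere l. sgn0 y * entry N z y) = sgn0 z * twist sgn0 N (dist0 z) l"
  proof (cases "refl0 z = z")
    case True
    \<comment> \<open>At a fixed vertex the sum equals its own negative, and \<open>sgn0 z\<close>
      is zero as well.\<close>
    then show ?thesis using neg[OF z] by (simp add: sgn0_def)
  next
    case False
    then have 1: "dist0 z \<in> {1..m}" using not_fixed_iff[OF z] by blast
    show ?thesis using z
    proof (cases rule: vertex_cases)
      case (1 k)
      then show ?thesis using \<open>dist0 z \<in> {1..m}\<close> by (simp add: twist_def sgn0_arc)
    next
      case (2 k)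
      note a = arc_mem[OF 2(1)]
      have "dist0 z = k" "sgn0 z = -1"
        using 2 1 sgn0_refl0[OF a] dist0_refl0[OF a] by (simp_all add: sgn0_arc)
      then show ?thesis using neg[OF a] 2 by (simp add: twist_def)
    qed
  qed
qed

text \<open>Equivariance replaces the inner sum by a multiple of \<open>\<chi> z\<close>; grouping
  the vertices \<open>z\<close> by distance then leaves a matrix product over the radii.\<close>

lemma twist_mult:
  assumes "M \<in> carrier_mat n n" "N \<in> carrier_mat n n" "equivariant \<chi> N" "k \<le> D"
  shows "twist \<chi> (M * N) k l = (\<Sum>j\<le>D. twist \<chi> M k j * twist \<chi> N j l)"
proof -
  have "twist \<chi> (M * N) k l = (\<Sum>y\<in>sphere l. \<Sum>z\<in>V. entry M (arc k) z * (\<chi> y * entry N z y))"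
    unfolding twist_def
    by (intro sum.cong refl)
      (simp add: entry_mult[OF assms(1,2) arc_mem[OF assms(4)]] sum_distrib_left mult_ac
        del: atLeastAtMost_iff One_nat_def)
  also have "\<dots> = (\<Sum>z\<in>V. entry M (arc k) z * (\<Sum>y\<in>sphere l. \<chi> y * entry N z y))"
    unfolding sum_distrib_left by (rule sum.swap)
  also have "\<dots> = (\<Sum>z\<in>V. entry M (arc k) z * (\<chi> z * twist \<chi> N (dist0 z) l))"
    using assms(3) unfolding equivariant_def by (intro sum.cong) auto
  also have "\<dots> = (\<Sum>j\<le>D. \<Sum>z\<in>sphere j. entry M (arc k) z * (\<chi> z * twist \<chi> N (dist0 z) l))"
    using dist0_le by (intro sum.group[symmetric]) auto
  also have "\<dots> = (\<Sum>j\<le>D. twist \<chi> M k j * twist \<chi> N j l)"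
    unfolding twist_def[of \<chi> M] sum_distrib_right
    by (intro sum.cong refl) (simp add: mult_ac)
  finally show ?thesis .
qed

lemma twist_add:
  assumes "M \<in> carrier_mat n n" "N \<in> carrier_mat n n" "k \<le> D"
  shows "twist \<chi> (M + N) k l = twist \<chi> M k l + twist \<chi> N k l"
  unfolding twist_def sum.distrib[symmetric] using assms arc_mem[OF assms(3)]
  by (intro sum.cong refl) (simp add: entry_add[where n = n] distrib_left del: atLeastAtMost_iff One_nat_def)

lemma twist_smult:
  assumes "M \<in> carrier_mat n n" "k \<le> D"
  shows "twist \<chi> (c \<cdot>\<^sub>m M) k l = c * twist \<chi> M k l"
  unfolding twist_def sum_distrib_left using assms arc_mem[OF assms(2)]
  by (intro sum.cong refl) (simp add: entry_smult[where n = n] del: atLeastAtMost_iff One_nat_def)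

lemma twist_one:
  assumes "k \<le> D"
  shows "twist \<chi> (1\<^sub>m n) k l = (if k = l then \<chi> (arc k) else 0)"
proof -
  have "twist \<chi> (1\<^sub>m n) k l = (\<Sum>y\<in>sphere l. if y = arc k then \<chi> y else 0)"
    unfolding twist_def using arc_mem[OF assms]
    by (intro sum.cong refl) (auto simp: entry_one simp del: atLeastAtMost_iff One_nat_def)
  then show ?thesis using arc_mem[OF assms] assms by (simp add: sum.delta)
qed

section \<open>The symmetric and the antisymmetric block\<close>

definition sym_block :: "complex mat \<Rightarrow> complex mat" where
  "sym_block M = mat (D + 1) (D + 1) (\<lambda>(k, l). twist (\<lambda>_. 1) M k l)"

text \<open>Index \<open>k\<close> stands for radius \<open>Suc k\<close>, since \<open>sgn0\<close>
  vanishes at the root.\<close>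

definition alt_block :: "complex mat \<Rightarrow> complex mat" where
  "alt_block M = mat m m (\<lambda>(k, l). twist sgn0 M (Suc k) (Suc l))"

lemma block_carrier:
  "sym_block M \<in> carrier_mat (D + 1) (D + 1)" "alt_block M \<in> carrier_mat m m"
  by (simp_all add: sym_block_def alt_block_def)

lemma m_le: "k < m \<Longrightarrow> Suc k \<le> D"
  by linarith

lemma sym_block_mult:
  assumes "M \<in> T4 n E x0" "N \<in> T4 n E x0"
  shows "sym_block (M * N) = sym_block M * sym_block N"
proof (rule eq_matI)
  fix k l assume "k < dim_row (sym_block M * sym_block N)" "l < dim_col (sym_block M * sym_block N)"
  then have kl: "k < D + 1" "l < D + 1" by (simp_all add: sym_block_def)
  have "sym_block (M * N) $$ (k, l) = (\<Sum>j\<le>D. twist (\<lambda>_. 1) M k j * twist (\<lambda>_. 1) N j l)"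
    using kl twist_mult[OF assms[THEN T4_carrier] equivariant_one[OF assms(2)]]
    by (simp add: sym_block_def)
  also have "{..D} = {0..<D + 1}" by auto
  finally show "sym_block (M * N) $$ (k, l) = (sym_block M * sym_block N) $$ (k, l)"
    using kl by (simp add: sym_block_def scalar_prod_def)
qed (simp_all add: sym_block_def)

lemma alt_block_mult:
  assumes "M \<in> T4 n E x0" "N \<in> T4 n E x0"
  shows "alt_block (M * N) = alt_block M * alt_block N"
proof (rule eq_matI)
  fix k l assume "k < dim_row (alt_block M * alt_block N)" "l < dim_col (alt_block M * alt_block N)"
  then have kl: "k < m" "l < m" by (simp_all add: alt_block_def)
  have "alt_block (M * N) $$ (k, l) = (\<Sum>j\<le>D. twist sgn0 M (Suc k) j * twist sgn0 N j (Suc l))"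
    using kl twist_mult[OF assms[THEN T4_carrier] equivariant_sgn0[OF assms(2)] m_le[OF kl(1)]]
    by (simp add: alt_block_def)
  \<comment> \<open>Radius \<open>0\<close>, and radius \<open>D\<close> for even \<open>n\<close>,
    drop out because \<open>sgn0\<close> vanishes there.\<close>
  also have "\<dots> = (\<Sum>j\<in>{1..m}. twist sgn0 M (Suc k) j * twist sgn0 N j (Suc l))"
    by (rule sum.mono_neutral_right) (use m_le twist_sgn0_eq_0 in auto)
  also have "\<dots> = (\<Sum>j\<in>{0..<m}. twist sgn0 M (Suc k) (Suc j) * twist sgn0 N (Suc j) (Suc l))"
    by (rule sum.reindex_bij_witness[where i = Suc and j = "\<lambda>j. j - 1"]) auto
  finally show "alt_block (M * N) $$ (k, l) = (alt_block M * alt_block N) $$ (k, l)"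
    using kl by (simp add: alt_block_def scalar_prod_def)
qed (simp_all add: alt_block_def)

lemma block_add:
  assumes "M \<in> carrier_mat n n" "N \<in> carrier_mat n n"
  shows "sym_block (M + N) = sym_block M + sym_block N" "alt_block (M + N) = alt_block M + alt_block N"
  by (rule eq_matI; use assms m_le in \<open>simp add: sym_block_def alt_block_def twist_add\<close>)+

lemma block_smult:
  assumes "M \<in> carrier_mat n n"
  shows "sym_block (c \<cdot>\<^sub>m M) = c \<cdot>\<^sub>m sym_block M" "alt_block (c \<cdot>\<^sub>m M) = c \<cdot>\<^sub>m alt_block M"
  by (rule eq_matI; use assms m_le in \<open>simp add: sym_block_def alt_block_def twist_smult\<close>)+

lemma block_one: "sym_block (1\<^sub>m n) = 1\<^sub>m (D + 1)" "alt_block (1\<^sub>m n) = 1\<^sub>m m"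
  by (rule eq_matI; use m_le in \<open>auto simp: sym_block_def alt_block_def twist_one sgn0_arc\<close>)+

text \<open>On a sphere of two vertices, the row sum plus \<open>sgn0 y\<close> times the signed row
  sum cancels the entry at the mirror image and doubles the one at \<open>y\<close>. On a sphere of
  one vertex the signed part is zero. Dividing by the size covers both cases.\<close>

lemma entry_eq_twist:
  assumes "M \<in> T4 n E x0" "x \<in> V" "y \<in> V"
  shows "entry M x y = (twist (\<lambda>_. 1) M (dist0 x) (dist0 y) + sgn0 x * sgn0 y * twist sgn0 M (dist0 x) (dist0 y))
    / card (sphere (dist0 y))"
proof -
  have "twist (\<lambda>_. 1) M (dist0 x) (dist0 y) = (\<Sum>z\<in>sphere (dist0 y). entry M x z)"
    using equivariant_one[OF assms(1)] assms(2) unfolding equivariant_def by simp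
  moreover have "sgn0 x * twist sgn0 M (dist0 x) (dist0 y) = (\<Sum>z\<in>sphere (dist0 y). sgn0 z * entry M x z)"
    using equivariant_sgn0[OF assms(1)] assms(2) unfolding equivariant_def by simp
  ultimately have "twist (\<lambda>_. 1) M (dist0 x) (dist0 y) + sgn0 x * sgn0 y * twist sgn0 M (dist0 x) (dist0 y)
      = (\<Sum>z\<in>sphere (dist0 y). entry M x z) + sgn0 y * (\<Sum>z\<in>sphere (dist0 y). sgn0 z * entry M x z)"
    by (simp add: mult_ac)
  also have "\<dots> = card (sphere (dist0 y)) * entry M x y"
    unfolding sphere_eq[OF assms(3)]
    using sgn0_refl0[OF assms(3)] sgn0_square[OF assms(3)] not_fixed_iff[OF assms(3)]
    by (cases "refl0 y = y") (simp_all add: sgn0_def[of y] algebra_simps)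
  also have "card (sphere (dist0 y)) \<noteq> 0" using assms(3) by (subst card_0_eq) auto
  ultimately show ?thesis by (simp add: field_simps)
qed

text \<open>
  Where \<open>dist0 x - 1\<close> is truncated or out of range for \<open>Q\<close>, the factor \<open>sgn0 x\<close> vanishes.
\<close>

definition glue :: "complex mat \<Rightarrow> complex mat \<Rightarrow> complex mat" where
  "glue P Q = mat n n (\<lambda>(i, j).
     (P $$ (dist0 (i + 1), dist0 (j + 1))
       + sgn0 (i + 1) * sgn0 (j + 1) * Q $$ (dist0 (i + 1) - 1, dist0 (j + 1) - 1))
     / card (sphere (dist0 (j + 1))))"

lemma entry_glue: "x \<in> V \<Longrightarrow> y \<in> V \<Longrightarrow> entry (glue P Q) x y =
    (P $$ (dist0 x, dist0 y) + sgn0 x * sgn0 y * Q $$ (dist0 x - 1, dist0 y - 1))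
      / card (sphere (dist0 y))"
  by (simp add: glue_def)

text \<open>Reflecting both indices preserves the distances and changes both signs, so their product
  stays the same.\<close>

lemma glue_in_T4: "glue P Q \<in> T4 n E x0"
  unfolding T4_eq_refl0_invariant
  using refl0_mem dist0_refl0 sgn0_refl0
  by (simp add: entry_glue del: atLeastAtMost_iff One_nat_def) (simp add: glue_def)

lemma card_sphere_pos: "l \<le> D \<Longrightarrow> card (sphere l) > 0"
  using arc_mem[of l] dist0_arc[of l] by (subst card_gt_0_iff) fastforce

text \<open>The two sums separate the blocks: for constant \<chi> the second one vanishes, for
  \<open>sgn0\<close> the first. On the radii of the block concerned, the other sum is the size of
  the sphere and cancels the denominator.\<close>

lemma twist_glue:
  assumes "k \<le> D" "l \<le> D"
  shows "twist \<chi> (glue P Q) k l = (P $$ (k, l) * (\<Sum>y\<in>sphere l. \<chi> y)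
    + sgn0 (arc k) * Q $$ (k - 1, l - 1) * (\<Sum>y\<in>sphere l. \<chi> y * sgn0 y)) / card (sphere l)"
  unfolding twist_def sum_distrib_left sum.distrib[symmetric] sum_divide_distrib
  using arc_mem[OF assms(1)] assms(1)
  by (intro sum.cong refl) (simp add: entry_glue algebra_simps del: atLeastAtMost_iff One_nat_def)

lemma sym_block_glue:
  assumes "P \<in> carrier_mat (D + 1) (D + 1)"
  shows "sym_block (glue P Q) = P"
proof (rule eq_matI)
  fix k l assume "k < dim_row P" "l < dim_col P"
  then have kl: "k \<le> D" "l \<le> D" using assms by auto
  then show "sym_block (glue P Q) $$ (k, l) = P $$ (k, l)"
    using card_sphere_pos[OF kl(2)] sum_sphere_sgn0[of l] by (simp add: sym_block_def twist_glue del: card_0_eq)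
qed (use assms in \<open>simp_all add: sym_block_def\<close>)

lemma alt_block_glue:
  assumes "Q \<in> carrier_mat m m"
  shows "alt_block (glue P Q) = Q"
proof (rule eq_matI)
  fix k l assume "k < dim_row Q" "l < dim_col Q"
  then have kl: "k < m" "l < m" using assms by auto
  have "(\<Sum>y\<in>sphere (Suc l). sgn0 y * sgn0 y) = (\<Sum>y\<in>sphere (Suc l). 1)"
    using kl by (intro sum.cong refl sgn0_square) auto
  then show "alt_block (glue P Q) $$ (k, l) = Q $$ (k, l)"
    using kl card_sphere_pos[OF m_le[OF kl(2)]] sum_sphere_sgn0[of "Suc l"] m_le
    by (simp add: alt_block_def twist_glue sgn0_arc del: card_0_eq)
qed (use assms in \<open>simp_all add: alt_block_def\<close>)

lemma glue_blocks:
  assumes "M \<in> T4 n E x0"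
  shows "glue (sym_block M) (alt_block M) = M"
proof (rule mat_eqI_entry[of _ n])
  fix x y assume xy: "x \<in> V" "y \<in> V"
  have "sgn0 x * sgn0 y * alt_block M $$ (dist0 x - 1, dist0 y - 1)
      = sgn0 x * sgn0 y * twist sgn0 M (dist0 x) (dist0 y)"
  proof (cases "dist0 x \<in> {1..m} \<and> dist0 y \<in> {1..m}")
    case True
    \<comment> \<open>In this range the index shift of \<open>alt_block\<close> is undone; outside
      it one of the signs is zero.\<close>
    then have "dist0 x - 1 < m" "dist0 y - 1 < m" "Suc (dist0 x - 1) = dist0 x" "Suc (dist0 y - 1) = dist0 y"
      by auto
    then show ?thesis by (simp only: alt_block_def index_mat prod.case)
  qed (use sgn0_eq_0 xy in auto)
  moreover have "sym_block M $$ (dist0 x, dist0 y) = twist (\<lambda>_. 1) M (dist0 x) (dist0 y)"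
    using dist0_le[OF xy(1)] dist0_le[OF xy(2)] by (simp add: sym_block_def)
  ultimately show "entry (glue (sym_block M) (alt_block M)) x y = entry M x y"
    unfolding entry_glue[OF xy] entry_eq_twist[OF assms xy] by simp
qed (simp_all add: glue_def T4_carrier[OF assms])

lemma T4_isomorphic:
  "algebra_isomorphic ((mat_algebra n)\<lparr>carrier := T4 n E x0\<rparr>)
    (algebra_sum (mat_algebra (D + 1)) (mat_algebra m))"
  (is "algebra_isomorphic ?P ?Q")
proof -
  let ?f = "\<lambda>M. (sym_block M, alt_block M)"
  have "?f \<in> ring_hom ?P ?Q"
    by (rule ring_hom_memI)
      (auto simp: algebra_sum_def module_mat_def sym_block_mult alt_block_mult block_add[OF T4_carrier T4_carrier]
        block_one block_carrier[simplified])
  \<comment> \<open>The map \<open>glue\<close> is a two-sided inverse of the pair of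
    blocks.\<close>
  moreover have "bij_betw ?f (carrier ?P) (carrier ?Q)"
    by (rule bij_betw_byWitness[where f' = "\<lambda>(P, Q). glue P Q"])
      (auto simp: algebra_sum_def module_mat_def glue_blocks sym_block_glue alt_block_glue glue_in_T4
          block_carrier[simplified])
  ultimately have "?f \<in> ring_iso ?P ?Q"
    by (simp add: ring_iso_def)
  moreover have "\<forall>c. \<forall>M\<in>carrier ?P. ?f (c \<odot>\<^bsub>?P\<^esub> M) = c \<odot>\<^bsub>?Q\<^esub> ?f M"
    by (simp add: algebra_sum_def module_mat_def block_smult[OF T4_carrier])
  ultimately show ?thesis unfolding algebra_isomorphic_def by (intro bexI[where x = ?f])
qed

end

theorem theorem7p8:
  fixes n x0 D :: nat
  assumes "n \<ge> 3" and "x0 \<in> {1..n}" and "D = n div 2"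
  shows "T2 n (cycle_edges n) x0 = T3 n (cycle_edges n) x0
    \<and> T3 n (cycle_edges n) x0 = T4 n (cycle_edges n) x0
    \<and> algebra_isomorphic
        ((mat_algebra n)\<lparr>carrier := T4 n (cycle_edges n) x0\<rparr>)
        (if even n
         then algebra_sum (mat_algebra (D + 1)) (mat_algebra (D - 1))
         else algebra_sum (mat_algebra (D + 1)) (mat_algebra D))"
proof -
  interpret rooted_cycle n x0 by standard (fact assms)+
  \<comment> \<open>For even \<open>n\<close> the antipode of the root is alone in its sphere, which
    costs the antisymmetric block one dimension.\<close>
  have "n - D - 1 = (if even n then D - 1 else D)"
    unfolding assms(3) by (auto elim!: evenE oddE)
  then show ?thesis
    using T2_eq_T3 T2_eq_T4 T4_isomorphic unfolding assms(3) by (simp split: if_splits)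
qed

end
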